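(* Let $(\mathfrak{g},\langle\cdot,\cdot\rangle)$ be a double extension of a metric Lie algebra $(\mathfrak{g}_0,\langle\cdot,\cdot\rangle_0)$ with data $(D,K,L)$, and let $\Delta\in\mathfrak{g}_0$ and $\Gamma\in\mathbb{R}$ be the associated vector and scalar. Assume that $(\mathfrak{g}_0,\langle\cdot,\cdot\rangle_0)$ is Ricci flat and $\Delta=0$. Then $(\mathfrak{g},\langle\cdot,\cdot\rangle)$ is Ricci-parallel. Moreover, if in addition $\Gamma\neq0$, then $(\mathfrak{g},\langle\cdot,\cdot\rangle)$ is Ricci-parallel with $\mathrm{Ric}\neq0$ and $\mathrm{Ric}^2=0$.
   Context: A metric Lie algebra $(\mathfrak{g},\langle\cdot,\cdot\rangle)$ is a finite-dimensional real Lie algebra $\mathfrak{g}$ with a nondegenerate symmetric bilinear form (of arbitrary signature). Its Levi-Civita connection is the bilinear map $\nabla$ given by $2\langle\nabla_xy,z\rangle=\langle[x,y],z\rangle+\langle[z,x],y\rangle+\langle x,[z,y]\rangle$. Its curvature is $R(x,y)z=\nabla_x\nabla_yz-\nabla_y\nabla_xz-\nabla_{[x,y]}z$, its Ricci tensor is $\mathrm{ric}(x,y)=\mathrm{tr}(\xi\mapsto R(\xi,x)y)$, and its Ricci operator $\mathrm{Ric}$ is defined by $\langle\mathrm{Ric}(x),y\rangle=\mathrm{ric}(x,y)$. It is Ricci flat if $\mathrm{ric}=0$, and Ricci-parallel if $\nabla\mathrm{ric}=0$, i.e. $\mathrm{ric}(\nabla_xy,z)+\mathrm{ric}(y,\nabla_xz)=0$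 for all $x,y,z$. Double extension: a metric Lie algebra $(\mathfrak{g},\langle\cdot,\cdot\rangle)$ is a double extension of a metric Lie algebra $(\mathfrak{g}_0,[\cdot,\cdot]_0,\langle\cdot,\cdot\rangle_0)$ with data $D,K\in\mathrm{End}(\mathfrak{g}_0)$, $L\in\mathfrak{g}_0$ if $\mathfrak{g}=\mathbb{R}u\oplus\mathbb{R}v\oplus\mathfrak{g}_0$ as a vector space, the Lie bracket of $\mathfrak{g}$ is $$[u,e]=D(e)+\langle L,e\rangle_0v,\quad [e,e']=[e,e']_0+\langle K(e),e'\rangle_0v,\quad [\mathfrak{g},v]=0\qquad(e,e'\in\mathfrak{g}_0)$$ (the data are such that this is a Lie bracket; in particular $K$ is skew-symmetric for $\langle\cdot,\cdot\rangle_0$ and $D$ is a derivation of $\mathfrak{g}_0$), and the metric satisfies $\langle u,v\rangle=1$, $\langle u,u\rangle=\langle v,v\rangle=0$, $\langle u,\mathfrak{g}_0\rangle=\langle v,\mathfrak{g}_0\rangle=0$, $\langle\cdot,\cdot\rangle|_{\mathfrak{g}_0}=\langle\cdot,\cdot\rangle_0$. For $A\in\mathrm{End}(\mathfrak{g}_0)$, $A^*$ is the adjoint with respect to $\langle\cdot,\cdot\rangle_0$; $\mathrm{ad}_0$ is the adjoint map of $\mathfrak{g}_0$; $Z_0\in\mathfrak{g}_0$ is the mean curvature vector, $\langle Z_0,f\rangle_0=\mathrm{tr}(\mathrm{ad}_0 f)$ for all $f\in\mathfrak{g}_0$; for $e\in\mathfrak{g}_0$, $S^0_e:\mathfrak{g}_0\to\mathfrak{g}_0$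 is $S^0_e(f)=(\mathrm{ad}_0f)^*(e)$. The vector $\Delta\in\mathfrak{g}_0$ is defined by $$\langle\Delta,e\rangle_0=-\tfrac12\mathrm{tr}((D+D^* )\circ\mathrm{ad}_0e)+\tfrac12\langle(D-K)(Z_0),e\rangle_0-\tfrac14\mathrm{tr}(KS^0_e),\quad\forall e\in\mathfrak{g}_0,$$ and $\Gamma=-\tfrac12\mathrm{tr}(D^2)-\tfrac12\mathrm{tr}(D^*D)-\tfrac14\mathrm{tr}(K^2)+\langle L,Z_0\rangle$. *)

theory Defs
  imports "HOL-Analysis.Analysis"
begin

text \<open>
  The Lie algebra is the whole type \<open>'a\<close>, a bare real vector space.  The class
  \<open>euclidean_space\<close> is avoided because it excludes dimension zero and comes with an
  inner product that has nothing to do with the (indefinite) metric.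
\<close>

definition finite_dim :: "'a::real_vector itself \<Rightarrow> bool" where
  "finite_dim _ \<longleftrightarrow> (\<exists>B::'a set. finite B \<and> span B = UNIV)"

definition lie_algebra :: "('a::real_vector \<Rightarrow> 'a \<Rightarrow> 'a) \<Rightarrow> bool" where
  "lie_algebra br \<longleftrightarrow>
     finite_dim TYPE('a) \<and> bilinear br \<and> (\<forall>x. br x x = 0) \<and>
     (\<forall>x y z. br x (br y z) + br y (br z x) + br z (br x y) = 0)"

definition metric :: "('a::real_vector \<Rightarrow> 'a \<Rightarrow> real) \<Rightarrow> bool" where
  "metric ip \<longleftrightarrow>
     bilinear ip \<and> (\<forall>x y. ip x y = ip y x) \<and> (\<forall>x. (\<forall>y. ip x y = 0) \<longrightarrow> x = 0)"

definition metric_lie_algebra ::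
  "('a::real_vector \<Rightarrow> 'a \<Rightarrow> 'a) \<Rightarrow> ('a \<Rightarrow> 'a \<Rightarrow> real) \<Rightarrow> bool" where
  "metric_lie_algebra br ip \<longleftrightarrow> lie_algebra br \<and> metric ip"

text \<open>
  Trace of a linear endomorphism of a finite-dimensional space: the sum of the diagonal
  entries of its matrix in a basis.  The choice of the basis is immaterial.
\<close>

definition endo_trace :: "('a::real_vector \<Rightarrow> 'a) \<Rightarrow> real" where
  "endo_trace f =
     (let B = (SOME B. independent B \<and> span B = UNIV) in \<Sum>b\<in>B. representation B (f b) b)"

text \<open>
  The vector metrically dual to a linear functional; it exists and is unique in finite
  dimension for nondegenerate \<open>ip\<close>.  All vectors that are defined below by prescribing
  their products with every vector are obtained through it.
\<close>

definition dual_vec :: "('a::real_vector \<Rightarrow> 'a \<Rightarrow> real) \<Rightarrow> ('a \<Rightarrow> real) \<Rightarrow> 'a" where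
  "dual_vec ip \<phi> = (THE w. \<forall>z. ip w z = \<phi> z)"

definition adj :: "('a::real_vector \<Rightarrow> 'a \<Rightarrow> real) \<Rightarrow> ('a \<Rightarrow> 'a) \<Rightarrow> 'a \<Rightarrow> 'a" where
  "adj ip A y = dual_vec ip (\<lambda>x. ip (A x) y)"

definition levi_civita ::
  "('a::real_vector \<Rightarrow> 'a \<Rightarrow> 'a) \<Rightarrow> ('a \<Rightarrow> 'a \<Rightarrow> real) \<Rightarrow> 'a \<Rightarrow> 'a \<Rightarrow> 'a" where
  "levi_civita br ip x y =
     dual_vec ip (\<lambda>z. (ip (br x y) z + ip (br z x) y + ip x (br z y)) / 2)"

definition curvature ::
  "('a::real_vector \<Rightarrow> 'a \<Rightarrow> 'a) \<Rightarrow> ('a \<Rightarrow> 'a \<Rightarrow> real) \<Rightarrow> 'a \<Rightarrow> 'a \<Rightarrow> 'a \<Rightarrow> 'a" where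
  "curvature br ip x y z =
     levi_civita br ip x (levi_civita br ip y z)
     - levi_civita br ip y (levi_civita br ip x z)
     - levi_civita br ip (br x y) z"

definition ricci ::
  "('a::real_vector \<Rightarrow> 'a \<Rightarrow> 'a) \<Rightarrow> ('a \<Rightarrow> 'a \<Rightarrow> real) \<Rightarrow> 'a \<Rightarrow> 'a \<Rightarrow> real" where
  "ricci br ip x y = endo_trace (\<lambda>\<xi>. curvature br ip \<xi> x y)"

definition ricci_op ::
  "('a::real_vector \<Rightarrow> 'a \<Rightarrow> 'a) \<Rightarrow> ('a \<Rightarrow> 'a \<Rightarrow> real) \<Rightarrow> 'a \<Rightarrow> 'a" where
  "ricci_op br ip x = dual_vec ip (\<lambda>y. ricci br ip x y)"

definition ricci_flat ::
  "('a::real_vector \<Rightarrow> 'a \<Rightarrow> 'a) \<Rightarrow> ('a \<Rightarrow> 'a \<Rightarrow> real) \<Rightarrow> bool" where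
  "ricci_flat br ip \<longleftrightarrow> (\<forall>x y. ricci br ip x y = 0)"

definition ricci_parallel ::
  "('a::real_vector \<Rightarrow> 'a \<Rightarrow> 'a) \<Rightarrow> ('a \<Rightarrow> 'a \<Rightarrow> real) \<Rightarrow> bool" where
  "ricci_parallel br ip \<longleftrightarrow>
     (\<forall>x y z. ricci br ip (levi_civita br ip x y) z + ricci br ip y (levi_civita br ip x z) = 0)"

text \<open>
  The inclusion of \<open>\<gg>\<^sub>0 = 'b\<close> in \<open>\<gg> = 'a = \<real>u \<oplus> \<real>v \<oplus> \<gg>\<^sub>0\<close>
  is the linear map \<open>\<iota>\<close>; the bijectivity clause states the decomposition and makes
  \<open>\<iota>\<close> injective.  It need not be a
  homomorphism of Lie algebras.  Skew-symmetry of \<open>K\<close> and the derivation property of \<open>D\<close>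
  are consequences of \<open>br\<close> being a Lie bracket.
\<close>

definition double_extension ::
  "('a::real_vector \<Rightarrow> 'a \<Rightarrow> 'a) \<Rightarrow> ('a \<Rightarrow> 'a \<Rightarrow> real) \<Rightarrow>
   ('b::real_vector \<Rightarrow> 'b \<Rightarrow> 'b) \<Rightarrow> ('b \<Rightarrow> 'b \<Rightarrow> real) \<Rightarrow>
   ('b \<Rightarrow> 'b) \<Rightarrow> ('b \<Rightarrow> 'b) \<Rightarrow> 'b \<Rightarrow> bool" where
  "double_extension br ip br0 ip0 D K L \<longleftrightarrow>
     metric_lie_algebra br ip \<and> metric_lie_algebra br0 ip0 \<and> linear D \<and> linear K \<and>
     (\<exists>u v (\<iota> :: 'b \<Rightarrow> 'a). linear \<iota> \<and>
        bij (\<lambda>(a, b, e). a *\<^sub>R u + b *\<^sub>R v + \<iota> e) \<and>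
        (\<forall>e. br u (\<iota> e) = \<iota> (D e) + ip0 L e *\<^sub>R v) \<and>
        (\<forall>e e'. br (\<iota> e) (\<iota> e') = \<iota> (br0 e e') + ip0 (K e) e' *\<^sub>R v) \<and>
        (\<forall>x. br x v = 0) \<and>
        ip u v = 1 \<and> ip u u = 0 \<and> ip v v = 0 \<and>
        (\<forall>e. ip u (\<iota> e) = 0) \<and> (\<forall>e. ip v (\<iota> e) = 0) \<and>
        (\<forall>e e'. ip (\<iota> e) (\<iota> e') = ip0 e e'))"

definition mean_curvature ::
  "('b::real_vector \<Rightarrow> 'b \<Rightarrow> 'b) \<Rightarrow> ('b \<Rightarrow> 'b \<Rightarrow> real) \<Rightarrow> 'b" where
  "mean_curvature br ip = dual_vec ip (\<lambda>f. endo_trace (br f))"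

definition S_map ::
  "('b::real_vector \<Rightarrow> 'b \<Rightarrow> 'b) \<Rightarrow> ('b \<Rightarrow> 'b \<Rightarrow> real) \<Rightarrow> 'b \<Rightarrow> 'b \<Rightarrow> 'b" where
  "S_map br ip e f = adj ip (br f) e"

definition dext_Delta ::
  "('b::real_vector \<Rightarrow> 'b \<Rightarrow> 'b) \<Rightarrow> ('b \<Rightarrow> 'b \<Rightarrow> real) \<Rightarrow> ('b \<Rightarrow> 'b) \<Rightarrow> ('b \<Rightarrow> 'b) \<Rightarrow> 'b" where
  "dext_Delta br0 ip0 D K = dual_vec ip0 (\<lambda>e.
     - (1/2) * endo_trace ((\<lambda>x. D x + adj ip0 D x) \<circ> br0 e)
     + (1/2) * ip0 (D (mean_curvature br0 ip0) - K (mean_curvature br0 ip0)) e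
     - (1/4) * endo_trace (K \<circ> S_map br0 ip0 e))"

definition dext_Gamma ::
  "('b::real_vector \<Rightarrow> 'b \<Rightarrow> 'b) \<Rightarrow> ('b \<Rightarrow> 'b \<Rightarrow> real) \<Rightarrow> ('b \<Rightarrow> 'b) \<Rightarrow> ('b \<Rightarrow> 'b) \<Rightarrow> 'b \<Rightarrow> real" where
  "dext_Gamma br0 ip0 D K L =
     - (1/2) * endo_trace (D \<circ> D) - (1/2) * endo_trace (adj ip0 D \<circ> D)
     - (1/4) * endo_trace (K \<circ> K) + ip0 L (mean_curvature br0 ip0)"

end

theory Submission
  imports Defs
begin

text \<open>
  Write \<open>\<rho>\<^sub>x z = \<nabla>\<^sub>z x\<close> and let \<open>H\<close> be the mean curvature vector.  The Ricci tensor of any metric Lie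
  algebra is \<open>ric(x, y) = - \<langle>H, \<nabla>\<^sub>x y\<rangle> - tr(\<rho>\<^sub>x \<rho>\<^sub>y)\<close>.  In a double extension \<open>v\<close> is
  parallel, since it is central and orthogonal to all brackets.  Hence each \<open>\<rho>\<^sub>x\<close> kills \<open>v\<close> and
  has its image in \<open>v\<^sup>\<bottom>\<close>, so that the trace only sees the compressions of \<open>\<rho>\<^sub>x\<close> and \<open>\<rho>\<^sub>y\<close> to
  \<open>\<gg>\<^sub>0\<close>; that of \<open>\<rho>\<^sub>u\<close> is \<open>- (D + D\<^sup>* + K) / 2\<close>.  Reading off the entries gives
  \<open>ric(x, y) = \<Gamma> \<langle>x, v\<rangle> \<langle>y, v\<rangle>\<close>, which is parallel because \<open>v\<close> is, and the Ricci operator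
  \<open>x \<mapsto> \<Gamma> \<langle>x, v\<rangle> v\<close> squares to zero because \<open>v\<close> is null.
\<close>

section \<open>Traces\<close>

text \<open>The last clause keeps the basis identical to the one chosen inside
  \<open>endo_trace\<close>, so that traces can be read off in it.\<close>

lemma finite_dim_basis:
  assumes "finite_dim TYPE('a::real_vector)"
  obtains B :: "'a::real_vector set" where "independent B" "span B = UNIV" "finite B"
    "B = (SOME B. independent B \<and> span B = UNIV)"
proof -
  obtain C :: "'a set" where C: "finite C" "span C = UNIV"
    using assms by (auto simp: finite_dim_def)
  define B :: "'a set" where "B = (SOME B. independent B \<and> span B = UNIV)"
  obtain B0 :: "'a set" where "independent B0" "UNIV \<subseteq> span B0"
    using real_vector.maximal_independent_subset by blast
  then have "\<exists>B :: 'a set. independent B \<and> span B = UNIV" by auto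
  from someI_ex[OF this] have B: "independent B" "span B = UNIV" by (auto simp: B_def)
  then have "finite B"
    using real_vector.independent_span_bound[OF C(1), of B] C(2) by simp
  with B show ?thesis using that B_def by blast
qed

lemma linear_representation:
  assumes "independent B" "span B = UNIV"
  shows "linear (\<lambda>x. representation B x b)"
  using assms by (intro linearI) (simp_all add: representation_add representation_scale)

lemma finite_dim_frame:
  assumes "finite_dim TYPE('a::real_vector)"
  obtains B :: "'a::real_vector set" and \<phi> where "finite B" "\<And>b. linear (\<phi> b :: 'a \<Rightarrow> real)"
    "\<And>x. (\<Sum>b\<in>B. \<phi> b x *\<^sub>R b) = x" "\<And>f. endo_trace f = (\<Sum>b\<in>B. \<phi> b (f b))"
proof -
  obtain B :: "'a set" where B: "independent B" "span B = UNIV" "finite B"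
    "B = (SOME B. independent B \<and> span B = UNIV)"
    using finite_dim_basis[OF assms] .
  show ?thesis
  proof (rule that[of B "\<lambda>b x. representation B x b"])
    show "endo_trace f = (\<Sum>b\<in>B. representation B (f b) b)" for f
      unfolding endo_trace_def Let_def B(4)[symmetric] ..
    show "linear (\<lambda>x. representation B x b)" for b
      by (rule linear_representation) (use B in auto)
    show "(\<Sum>b\<in>B. representation B x b *\<^sub>R b) = x" for x
      using B(1-3) by (intro real_vector.sum_representation_eq) auto
  qed (fact B(3))
qed

text \<open>Expanding in both families gives the same double sum of
  \<open>\<phi> i b * \<psi> b (f (w i))\<close>. It allows traces to be computed in a metrically
  dual family.\<close>

lemma endo_trace_frame:
  fixes f :: "'a::real_vector \<Rightarrow> 'a" and \<phi> :: "'i \<Rightarrow> 'a \<Rightarrow> real"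
  assumes fd: "finite_dim TYPE('a)" and f: "linear f" and "finite I"
    and \<phi>: "\<And>i. linear (\<phi> i)" and w: "\<And>x. (\<Sum>i\<in>I. \<phi> i x *\<^sub>R w i) = x"
  shows "endo_trace f = (\<Sum>i\<in>I. \<phi> i (f (w i)))"
proof -
  obtain B :: "'a set" and \<psi> where B: "finite B" "\<And>b. linear (\<psi> b :: 'a \<Rightarrow> real)"
    "\<And>x. (\<Sum>b\<in>B. \<psi> b x *\<^sub>R b) = x" "endo_trace f = (\<Sum>b\<in>B. \<psi> b (f b))"
    using finite_dim_frame[OF fd] by metis
  have "\<psi> b (f b) = (\<Sum>i\<in>I. \<phi> i b * \<psi> b (f (w i)))" for b
  proof -
    have "\<psi> b (f b) = \<psi> b (f (\<Sum>i\<in>I. \<phi> i b *\<^sub>R w i))" by (simp only: w)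
    then show ?thesis
      using f B(2) by (simp add: linear_sum linear_cmul)
  qed
  then have "endo_trace f = (\<Sum>b\<in>B. \<Sum>i\<in>I. \<phi> i b * \<psi> b (f (w i)))"
    by (simp add: B(4))
  also have "\<dots> = (\<Sum>i\<in>I. \<Sum>b\<in>B. \<phi> i b * \<psi> b (f (w i)))"
    by (rule sum.swap)
  also have "\<dots> = (\<Sum>i\<in>I. \<phi> i (\<Sum>b\<in>B. \<psi> b (f (w i)) *\<^sub>R b))"
    using \<phi> by (simp add: linear_sum linear_cmul mult.commute)
  finally show ?thesis by (simp add: B(3))
qed

text \<open>Both traces are the sum of products of matrix entries of \<open>f\<close> and
  \<open>g\<close>. Having two different spaces is what later moves a trace from \<open>'a\<close>
  to \<open>'b\<close>.\<close>

lemma endo_trace_commute: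
  fixes f :: "'b::real_vector \<Rightarrow> 'a::real_vector" and g :: "'a \<Rightarrow> 'b"
  assumes fda: "finite_dim TYPE('a)" and fdb: "finite_dim TYPE('b)"
    and f: "linear f" and g: "linear g"
  shows "endo_trace (\<lambda>x. f (g x)) = endo_trace (\<lambda>x. g (f x))"
proof -
  obtain A :: "'a set" and \<phi> where A: "finite A" "\<And>b. linear (\<phi> b :: 'a \<Rightarrow> real)"
    "\<And>x. (\<Sum>b\<in>A. \<phi> b x *\<^sub>R b) = x" "\<And>f. endo_trace f = (\<Sum>b\<in>A. \<phi> b (f b))"
    using finite_dim_frame[OF fda] by metis
  obtain B :: "'b set" and \<psi> where B: "finite B" "\<And>b. linear (\<psi> b :: 'b \<Rightarrow> real)"
    "\<And>x. (\<Sum>b\<in>B. \<psi> b x *\<^sub>R b) = x" "\<And>f. endo_trace f = (\<Sum>b\<in>B. \<psi> b (f b))"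
    using finite_dim_frame[OF fdb] by metis
  have "\<phi> a (f (g a)) = (\<Sum>b\<in>B. \<psi> b (g a) * \<phi> a (f b))" for a
  proof -
    have "\<phi> a (f (g a)) = \<phi> a (f (\<Sum>b\<in>B. \<psi> b (g a) *\<^sub>R b))" by (simp only: B(3))
    then show ?thesis
      using f A(2) by (simp add: linear_sum linear_cmul)
  qed
  then have "endo_trace (\<lambda>x. f (g x)) = (\<Sum>a\<in>A. \<Sum>b\<in>B. \<psi> b (g a) * \<phi> a (f b))"
    by (simp add: A(4))
  also have "\<dots> = (\<Sum>b\<in>B. \<Sum>a\<in>A. \<psi> b (g a) * \<phi> a (f b))"
    by (rule sum.swap)
  also have "\<dots> = (\<Sum>b\<in>B. \<psi> b (g (\<Sum>a\<in>A. \<phi> a (f b) *\<^sub>R a)))"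
    using g B(2) by (simp add: linear_sum linear_cmul mult.commute)
  finally show ?thesis by (simp add: A(3) B(4))
qed

context
  assumes fd: "finite_dim TYPE('a::real_vector)"
begin

lemma endo_trace_add:
  fixes f g :: "'a \<Rightarrow> 'a"
  shows "endo_trace (\<lambda>x. f x + g x) = endo_trace f + endo_trace g"
proof -
  obtain A :: "'a set" and \<phi> where A: "\<And>b. linear (\<phi> b :: 'a \<Rightarrow> real)"
    "\<And>f. endo_trace f = (\<Sum>b\<in>A. \<phi> b (f b))"
    using finite_dim_frame[OF fd] by metis
  show ?thesis by (simp add: A(2) linear_add[OF A(1)] sum.distrib)
qed

lemma endo_trace_scale:
  fixes f :: "'a \<Rightarrow> 'a"
  shows "endo_trace (\<lambda>x. c *\<^sub>R f x) = c * endo_trace f"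
proof -
  obtain A :: "'a set" and \<phi> where A: "\<And>b. linear (\<phi> b :: 'a \<Rightarrow> real)"
    "\<And>f. endo_trace f = (\<Sum>b\<in>A. \<phi> b (f b))"
    using finite_dim_frame[OF fd] by metis
  show ?thesis by (simp add: A(2) linear_cmul[OF A(1)] sum_distrib_left)
qed

lemma endo_trace_minus:
  fixes f :: "'a \<Rightarrow> 'a"
  shows "endo_trace (\<lambda>x. - f x) = - endo_trace f"
  using endo_trace_scale[of "-1" f] by simp

lemma endo_trace_diff:
  fixes f g :: "'a \<Rightarrow> 'a"
  shows "endo_trace (\<lambda>x. f x - g x) = endo_trace f - endo_trace g"
  using endo_trace_add[of f "\<lambda>x. - g x"] endo_trace_minus[of g] by simp

lemma endo_trace_rank_one:
  fixes \<psi> :: "'a \<Rightarrow> real" and w :: 'a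
  assumes "linear \<psi>"
  shows "endo_trace (\<lambda>x. \<psi> x *\<^sub>R w) = \<psi> w"
proof -
  obtain A :: "'a set" and \<phi> where A: "finite A" "\<And>b. linear (\<phi> b :: 'a \<Rightarrow> real)"
    "\<And>x. (\<Sum>b\<in>A. \<phi> b x *\<^sub>R b) = x" "\<And>f. endo_trace f = (\<Sum>b\<in>A. \<phi> b (f b))"
    using finite_dim_frame[OF fd] by metis
  have "endo_trace (\<lambda>x. \<psi> x *\<^sub>R w) = \<psi> (\<Sum>b\<in>A. \<phi> b w *\<^sub>R b)"
    using assms A(2) by (simp add: A(4) linear_sum linear_cmul mult.commute)
  then show ?thesis by (simp add: A(3))
qed

end

section \<open>Nondegenerate metrics\<close>

locale nondegenerate_metric =
  fixes ip :: "'a::real_vector \<Rightarrow> 'a \<Rightarrow> real"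
  assumes fd: "finite_dim TYPE('a)" and metric: "metric ip"
begin

lemma bil: "bilinear ip" and sym: "ip x y = ip y x"
  and nondegenerate: "(\<And>y. ip x y = 0) \<Longrightarrow> x = 0"
  using metric by (auto simp: metric_def)

lemmas ip_simps [simp] =
  bilinear_ladd[OF bil] bilinear_radd[OF bil] bilinear_lmul[OF bil] bilinear_rmul[OF bil]
  bilinear_lneg[OF bil] bilinear_rneg[OF bil] bilinear_lzero[OF bil] bilinear_rzero[OF bil]
  bilinear_lsub[OF bil] bilinear_rsub[OF bil]

lemma linear_ip: "linear (ip x)" "linear (\<lambda>x. ip x y)"
  using bil by (auto simp: bilinear_def)

lemma ip_eqI: "x = y" if "\<And>z. ip x z = ip y z"
  using nondegenerate[of "x - y"] that by simp

lemma dual_vec_eqI: "dual_vec ip \<phi> = w" if "\<And>z. ip w z = \<phi> z"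
  unfolding dual_vec_def by (rule the_equality) (use that ip_eqI in auto)

text \<open>The map \<open>T\<close>, which records the products of a vector with a basis, is
  injective by nondegeneracy, hence onto in finite dimension; a preimage of the vector with
  coordinates \<open>\<phi> b\<close> represents \<open>\<phi>\<close>.\<close>

lemma riesz:
  assumes \<phi>: "linear \<phi>"
  obtains w where "\<And>z. ip w z = \<phi> z"
proof -
  obtain B :: "'a set" where B: "independent B" "span B = UNIV" "finite B"
    using finite_dim_basis[OF fd] .
  interpret fv: finite_dimensional_vector_space "scaleR :: real \<Rightarrow> 'a \<Rightarrow> 'a" B
    by unfold_locales (use B in \<open>auto simp: dependent_raw_def span_raw_def\<close>)
  define T where "T = (\<lambda>w. \<Sum>b\<in>B. ip w b *\<^sub>R b)"
  have T: "linear T"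
    by (rule linearI) (simp_all add: T_def sum.distrib scaleR_add_left scaleR_sum_right)
  have coeff: "c b = 0" if "(\<Sum>b\<in>B. c b *\<^sub>R b) = 0" "b \<in> B" for c :: "'a \<Rightarrow> real" and b
    using that B real_vector.dependent_finite by blast
  have agree: "ip w z = \<phi> z" if "\<And>b. b \<in> B \<Longrightarrow> ip w b = \<phi> b" "linear \<phi>" for w z \<phi>
    by (rule linear_eq_on_span[OF linear_ip(1) that(2), where B = B]) (use that B in auto)
  have "inj T"
  proof (rule linear_injective_0[OF T, THEN iffD2], intro allI impI)
    fix w assume "T w = 0"
    then have "ip w b = 0" if "b \<in> B" for b
      using coeff[of "ip w"] that by (simp add: T_def)
    then show "w = 0"
      using agree[of w "\<lambda>_. 0"] nondegenerate[of w] by (simp add: linear_zero)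
  qed
  then have "surj T"
    using fv.linear_inj_imp_surj[of T] T by (simp add: linear_def real_scaleR_def)
  then obtain w where "T w = (\<Sum>b\<in>B. \<phi> b *\<^sub>R b)" by (metis surjD)
  then have "(\<Sum>b\<in>B. (ip w b - \<phi> b) *\<^sub>R b) = 0"
    by (simp add: T_def scaleR_diff_left sum_subtractf)
  then have "ip w b = \<phi> b" if "b \<in> B" for b
    using coeff[of "\<lambda>b. ip w b - \<phi> b"] that by simp
  then show ?thesis using that agree \<phi> by blast
qed

lemma ip_dual_vec: "ip (dual_vec ip \<phi>) z = \<phi> z" if "linear \<phi>"
  using riesz[OF that] dual_vec_eqI by metis

lemma linear_dual_vec:
  fixes \<phi> :: "'c::real_vector \<Rightarrow> 'a \<Rightarrow> real"
  assumes "bilinear \<phi>"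
  shows "linear (\<lambda>x. dual_vec ip (\<phi> x))"
proof -
  have "linear (\<phi> x)" for x using assms by (simp add: bilinear_def)
  then show ?thesis
    by (intro linearI ip_eqI)
      (simp_all add: ip_dual_vec bilinear_ladd[OF assms] bilinear_lmul[OF assms])
qed

lemma ip_adj: "ip (adj ip A y) x = ip y (A x)" if "linear A"
  unfolding adj_def
  by (subst ip_dual_vec)
    (use that sym in \<open>auto simp: linear_add linear_cmul intro!: linearI\<close>)

lemma linear_adj: "linear (adj ip A)" if "linear A"
  by (intro linearI ip_eqI) (simp_all add: ip_adj that)

lemma endo_trace_adjoint:
  assumes A: "linear A" "linear A'" and adj: "\<And>x y. ip (A x) y = ip x (A' y)"
  shows "endo_trace A = endo_trace A'"
proof -
  obtain B :: "'a set" and \<phi> where B: "finite B" "\<And>b. linear (\<phi> b :: 'a \<Rightarrow> real)"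
    "\<And>x. (\<Sum>b\<in>B. \<phi> b x *\<^sub>R b) = x" "\<And>f. endo_trace f = (\<Sum>b\<in>B. \<phi> b (f b))"
    using finite_dim_frame[OF fd] by metis
  \<comment> \<open>The metrically dual basis: the coefficient of \<open>x\<close> along
    \<open>d b\<close> is \<open>ip b x\<close>.\<close>
  define d where "d b = dual_vec ip (\<phi> b)" for b
  have d: "ip (d b) x = \<phi> b x" for b x
    by (simp add: d_def ip_dual_vec B(2))
  have dual: "(\<Sum>b\<in>B. ip b x *\<^sub>R d b) = x" for x
  proof (rule ip_eqI)
    fix z
    have "ip (\<Sum>b\<in>B. ip b x *\<^sub>R d b) z = (\<Sum>b\<in>B. ip b x * \<phi> b z)"
      by (simp add: linear_sum[OF linear_ip(2)] d)
    also have "\<dots> = ip x (\<Sum>b\<in>B. \<phi> b z *\<^sub>R b)"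
      by (simp add: linear_sum[OF linear_ip(1)] sym[of x] mult.commute)
    finally show "ip (\<Sum>b\<in>B. ip b x *\<^sub>R d b) z = ip x z" by (simp add: B(3))
  qed
  have "endo_trace A' = (\<Sum>b\<in>B. ip b (A' (d b)))"
    by (rule endo_trace_frame[OF fd A(2) B(1)]) (use linear_ip dual in auto)
  also have "\<dots> = (\<Sum>b\<in>B. \<phi> b (A b))"
    by (simp add: adj[symmetric] sym[of _ "d _"] d)
  finally show ?thesis by (simp add: B(4))
qed

text \<open>The adjoint of \<open>AB\<close> is \<open>-BA\<close>, so by cyclicity the trace equals
  its own negative. All mixed terms in the Ricci entries below vanish this way.\<close>

lemma endo_trace_selfadjoint_skew:
  assumes "linear A" "linear B" "\<And>x y. ip (A x) y = ip x (A y)"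
    and "\<And>x y. ip (B x) y = - ip x (B y)"
  shows "endo_trace (\<lambda>x. A (B x)) = 0"
proof -
  have "endo_trace (\<lambda>x. A (B x)) = endo_trace (\<lambda>x. - B (A x))"
    using assms by (intro endo_trace_adjoint)
      (auto simp: linear_add linear_cmul intro!: linearI)
  also have "\<dots> = - endo_trace (\<lambda>x. A (B x))"
    by (simp add: endo_trace_minus[OF fd] endo_trace_commute[OF fd fd assms(1,2)])
  finally show ?thesis by simp
qed

lemma endo_trace_skew:
  assumes "linear A" "\<And>x y. ip (A x) y = - ip x (A y)"
  shows "endo_trace A = 0"
  using endo_trace_selfadjoint_skew[of "\<lambda>x. x" A] assms by (simp add: linear_id[unfolded id_def])

end

section \<open>The Ricci tensor of a metric Lie algebra\<close>

locale metric_lie =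
  fixes br :: "'a::real_vector \<Rightarrow> 'a \<Rightarrow> 'a" and ip :: "'a \<Rightarrow> 'a \<Rightarrow> real"
  assumes mla: "metric_lie_algebra br ip"

sublocale metric_lie \<subseteq> nondegenerate_metric ip
  using mla by unfold_locales (auto simp: metric_lie_algebra_def lie_algebra_def)

context metric_lie
begin

lemma br_bil: "bilinear br" and br_self [simp]: "br x x = 0"
  and jacobi: "br x (br y z) + br y (br z x) + br z (br x y) = 0"
  using mla by (auto simp: metric_lie_algebra_def lie_algebra_def)

lemmas br_simps [simp] =
  bilinear_ladd[OF br_bil] bilinear_radd[OF br_bil] bilinear_lmul[OF br_bil] bilinear_rmul[OF br_bil]
  bilinear_lneg[OF br_bil] bilinear_rneg[OF br_bil] bilinear_lzero[OF br_bil] bilinear_rzero[OF br_bil]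
  bilinear_lsub[OF br_bil] bilinear_rsub[OF br_bil]

lemma br_anti: "br x y = - br y x"
  using br_self[of "x + y"] br_self[of x] br_self[of y]
  by (simp add: eq_neg_iff_add_eq_0 add.commute del: br_self)

lemma linear_br: "linear (br x)" "linear (\<lambda>x. br x y)"
  using br_bil by (auto simp: bilinear_def)

abbreviation conn :: "'a \<Rightarrow> 'a \<Rightarrow> 'a" where "conn \<equiv> levi_civita br ip"
abbreviation H :: 'a where "H \<equiv> mean_curvature br ip"

lemma conn: "ip (conn x y) z = (ip (br x y) z + ip (br z x) y + ip x (br z y)) / 2"
  unfolding levi_civita_def
  by (rule ip_dual_vec) (intro linearI; simp add: field_simps)

lemma conn_bil: "bilinear conn"
  unfolding bilinear_def
  by (intro conjI allI linearI ip_eqI; simp add: conn field_simps)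

lemmas conn_simps [simp] =
  bilinear_ladd[OF conn_bil] bilinear_radd[OF conn_bil] bilinear_lmul[OF conn_bil] bilinear_rmul[OF conn_bil]
  bilinear_lneg[OF conn_bil] bilinear_rneg[OF conn_bil] bilinear_lzero[OF conn_bil] bilinear_rzero[OF conn_bil]
  bilinear_lsub[OF conn_bil] bilinear_rsub[OF conn_bil]

lemma linear_conn: "linear (conn x)" "linear (\<lambda>x. conn x y)"
  using conn_bil by (auto simp: bilinear_def)

lemma torsion_free: "conn x y = conn y x + br x y"
proof (rule ip_eqI)
  fix z
  show "ip (conn x y) z = ip (conn y x + br x y) z"
    using br_anti[of y x] sym[of x "br z y"] sym[of y "br z x"]
    by (simp add: conn field_simps)
qed

text \<open>Exchanging \<open>y\<close> and \<open>z\<close> in Koszul's formula only flips the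
  sign, by antisymmetry of the bracket.\<close>

lemma conn_skew: "ip (conn x y) z = - ip y (conn x z)"
  using br_anti[of y x] br_anti[of z x] br_anti[of z y]
    sym[of y "conn x z"] sym[of "br x z" y] sym[of x "br z y"] sym[of x "br y z"]
    sym[of "br x y" z]
  by (simp add: conn field_simps)

lemma mean_curvature: "ip H x = endo_trace (br x)"
  unfolding mean_curvature_def
proof (rule ip_dual_vec, rule linearI)
  show "endo_trace (br (x + y)) = endo_trace (br x) + endo_trace (br y)" for x y
    using endo_trace_add[OF fd, of "br x" "br y"] by (simp flip: br_simps(1))
  show "endo_trace (br (c *\<^sub>R x)) = c *\<^sub>R endo_trace (br x)" for c x
    using endo_trace_scale[OF fd, of c "br x"] by (simp flip: br_simps(3))
qed

text \<open>By the Jacobi identity \<open>ad [x, y]\<close> is the commutator of \<open>ad x\<close>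
  and \<open>ad y\<close>.\<close>

lemma endo_trace_ad_commutator: "endo_trace (br (br x y)) = 0"
proof -
  have "br (br x y) = (\<lambda>z. br x (br y z) - br y (br x z))"
  proof
    fix z
    have "br z (br x y) = - br (br x y) z" "br z x = - br x z"
      by (rule br_anti)+
    then show "br (br x y) z = br x (br y z) - br y (br x z)"
      using jacobi[of x y z] by (simp add: algebra_simps)
  qed
  then show ?thesis
    by (simp add: endo_trace_diff[OF fd] endo_trace_commute[OF fd fd linear_br(1) linear_br(1), of x y])
qed

text \<open>
  Since \<open>\<nabla>\<^sub>z x = \<nabla>\<^sub>x z - [x, z]\<close> and \<open>\<nabla>\<^sub>x\<close> is skew, the map \<open>z \<mapsto> \<nabla>\<^sub>z x\<close> has
  trace \<open>- tr (ad x)\<close>; the three terms of the curvature then collapse to a single product.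
\<close>

lemma ricci_eq_trace:
  "ricci br ip x y = - ip H (conn x y) - endo_trace (\<lambda>z. conn (conn z y) x)"
proof -
  have torsion: "conn x z = conn z x - br z x" for x z
    using torsion_free[of z x] by simp
  have "endo_trace (conn w) = 0" for w
    by (rule endo_trace_skew) (auto intro: linear_conn conn_skew)
  then have tr_\<rho>: "endo_trace (\<lambda>z. conn z w) = - ip H w" for w
    by (simp add: torsion[of _ w] endo_trace_diff[OF fd] mean_curvature)
  have lin: "linear (\<lambda>z. conn x (conn z y))" "linear (\<lambda>z. br x (conn z y))"
    by (auto intro!: linearI)
  have "curvature br ip z x y = conn z (conn x y) - conn x (conn z y) + conn (br x z) y" for z
    by (simp add: curvature_def br_anti[of z x])
  then have "ricci br ip x y = - ip H (conn x y) - endo_trace (\<lambda>z. conn x (conn z y))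
      + endo_trace (\<lambda>z. conn (br x z) y)"
    by (simp add: ricci_def endo_trace_add[OF fd] endo_trace_diff[OF fd] tr_\<rho>)
  \<comment> \<open>Cyclicity makes \<open>ad x\<close> act on \<open>conn z y\<close>, just as
    \<open>conn x\<close> does; their difference is then given by
    \<open>torsion_free\<close>.\<close>
  also have "endo_trace (\<lambda>z. conn (br x z) y) = endo_trace (\<lambda>z. br x (conn z y))"
    by (rule endo_trace_commute[OF fd fd linear_conn(2) linear_br(1)])
  also have "- ip H (conn x y) - endo_trace (\<lambda>z. conn x (conn z y))
      + endo_trace (\<lambda>z. br x (conn z y)) =
      - ip H (conn x y) - endo_trace (\<lambda>z. conn (conn z y) x)"
    by (simp add: torsion_free[of x "conn _ y"] endo_trace_add[OF fd])
  finally show ?thesis .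
qed

text \<open>\<open>H\<close> is orthogonal to all brackets, so one Koszul term of
  \<open>ip H (conn x y)\<close> drops out and \<open>H\<close> enters only through
  \<open>ad H\<close>.\<close>

lemma ricci_formula:
  "ricci br ip x y = - (ip (br H x) y + ip x (br H y)) / 2 - endo_trace (\<lambda>z. conn (conn z y) x)"
proof -
  have "ip (br x y) H = 0"
    using mean_curvature[of "br x y"] endo_trace_ad_commutator sym by metis
  then show ?thesis
    by (simp add: ricci_eq_trace sym[of H] conn field_simps)
qed

lemma ricci_sym: "ricci br ip x y = ricci br ip y x"
  unfolding ricci_formula
  using endo_trace_commute[OF fd fd linear_conn(2)[of x] linear_conn(2)[of y]]
  by (simp add: sym[of x "br H y"] sym[of y "br H x"])

lemma linear_ricci: "linear (ricci br ip x)"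
  by (rule linearI)
    (simp_all add: ricci_formula endo_trace_add[OF fd] endo_trace_scale[OF fd] field_simps)

lemma ricci_bil: "bilinear (ricci br ip)"
  unfolding bilinear_def using linear_ricci by (simp add: ricci_sym[of _ "_ :: 'a"])

end

section \<open>Double extensions\<close>

locale dext = g: metric_lie br ip + g0: metric_lie br0 ip0
  for br :: "'a::real_vector \<Rightarrow> 'a \<Rightarrow> 'a" and ip :: "'a \<Rightarrow> 'a \<Rightarrow> real"
    and br0 :: "'b::real_vector \<Rightarrow> 'b \<Rightarrow> 'b" and ip0 :: "'b \<Rightarrow> 'b \<Rightarrow> real" +
  fixes D K :: "'b \<Rightarrow> 'b" and L :: 'b and u v :: 'a and \<iota> :: "'b \<Rightarrow> 'a"
  assumes D: "linear D" and K: "linear K" and \<iota>: "linear \<iota>"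
    and bij: "bij (\<lambda>(a, b, e). a *\<^sub>R u + b *\<^sub>R v + \<iota> e)"
    and br_u_\<iota> [simp]: "br u (\<iota> e) = \<iota> (D e) + ip0 L e *\<^sub>R v"
    and br_\<iota>_\<iota> [simp]: "br (\<iota> e) (\<iota> f) = \<iota> (br0 e f) + ip0 (K e) f *\<^sub>R v"
    and br_v [simp]: "br x v = 0"
    and ip_uv [simp]: "ip u v = 1" "ip u u = 0" "ip v v = 0"
    and ip_\<iota> [simp]: "ip u (\<iota> e) = 0" "ip v (\<iota> e) = 0"
    and ip_\<iota>_\<iota> [simp]: "ip (\<iota> e) (\<iota> f) = ip0 e f"
begin

section \<open>Splitting along the hyperbolic plane of \<open>u\<close> and \<open>v\<close>\<close>

lemma ip_flip [simp]: "ip v u = 1" "ip (\<iota> e) u = 0" "ip (\<iota> e) v = 0"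
  using g.sym[of v u] g.sym[of "\<iota> e" u] g.sym[of "\<iota> e" v] by simp_all

lemma br_flip [simp]: "br v x = 0" "br (\<iota> e) u = - \<iota> (D e) - ip0 L e *\<^sub>R v"
  using g.br_anti[of v x] g.br_anti[of "\<iota> e" u] by simp_all

lemmas \<iota>_simps [simp] = linear_add[OF \<iota>] linear_cmul[OF \<iota>] linear_diff[OF \<iota>] linear_neg[OF \<iota>] linear_0[OF \<iota>]

text \<open>Pairing with \<open>u\<close> extracts the \<open>v\<close>-coefficient
  \<open>ip0 (K e) e\<close> of \<open>br (\<iota> e) (\<iota> e) = 0\<close>; polarization does the
  rest.\<close>

lemma K_skew: "ip0 (K e) f = - ip0 (K f) e"
proof -
  have "ip0 (K e) e = 0" for e
  proof -
    have "ip (br (\<iota> e) (\<iota> e)) u = 0" by (simp only: g.br_self g.ip_simps)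
    then show ?thesis by (simp del: g.br_self)
  qed
  from this[of "e + f"] this[of e] this[of f] show ?thesis
    by (simp add: linear_add[OF K])
qed

text \<open>The orthogonal projection onto the image of \<open>\<iota>\<close>, read in
  \<open>'b\<close>.\<close>

definition \<pi> :: "'a \<Rightarrow> 'b" where "\<pi> x = dual_vec ip0 (\<lambda>f. ip x (\<iota> f))"

lemma ip0_\<pi> [simp]: "ip0 (\<pi> x) f = ip x (\<iota> f)"
  unfolding \<pi>_def by (rule g0.ip_dual_vec) (auto intro!: linearI)

lemma linear_\<pi>: "linear \<pi>"
  by (intro linearI g0.ip_eqI) simp_all

lemma \<pi>_simps [simp]: "\<pi> (\<iota> e) = e" "\<pi> u = 0" "\<pi> v = 0"
  by (rule g0.ip_eqI; simp)+

text \<open>As \<open>u\<close> and \<open>v\<close> are null with product 1, the coefficient of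
  each is the product with the other.\<close>

lemma decomposition: "x = ip x v *\<^sub>R u + ip x u *\<^sub>R v + \<iota> (\<pi> x)"
proof -
  obtain a b e where x: "x = a *\<^sub>R u + b *\<^sub>R v + \<iota> e"
    using bij_is_surj[OF bij] by (metis (mono_tags, lifting) surjD case_prod_beta)
  have "\<pi> x = e" by (rule g0.ip_eqI) (simp add: x)
  then show ?thesis by (simp add: x)
qed

text \<open>\<open>F\<close> is a sum of two rank one maps and
  \<open>F \<circ> \<iota> \<circ> \<pi>\<close>; cyclicity turns the trace of the latter into that
  of \<open>\<pi> \<circ> F \<circ> \<iota>\<close>.\<close>

lemma endo_trace_decomposition:
  assumes F: "linear F"
  shows "endo_trace F = ip (F u) v + ip (F v) u + endo_trace (\<lambda>e. \<pi> (F (\<iota> e)))"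
proof -
  have "F x = ip x v *\<^sub>R F u + ip x u *\<^sub>R F v + F (\<iota> (\<pi> x))" for x
    by (subst decomposition[of x]) (simp only: linear_add[OF F] linear_cmul[OF F])
  then have "endo_trace F = endo_trace (\<lambda>x. ip x v *\<^sub>R F u + ip x u *\<^sub>R F v + F (\<iota> (\<pi> x)))"
    by (intro arg_cong[of _ _ endo_trace] ext)
  also have "\<dots> = ip (F u) v + ip (F v) u + endo_trace (\<lambda>x. F (\<iota> (\<pi> x)))"
    by (simp add: endo_trace_add[OF g.fd] endo_trace_rank_one[OF g.fd] g.linear_ip(2))
  also have "endo_trace (\<lambda>x. F (\<iota> (\<pi> x))) = endo_trace (\<lambda>e. \<pi> (F (\<iota> e)))"
    using endo_trace_commute[OF g.fd g0.fd linear_compose[OF \<iota> F] linear_\<pi>] by simp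
  finally show ?thesis .
qed

section \<open>Parallelism of \<open>v\<close> and reduction of the Ricci tensor to traces on
  \<open>'b\<close>\<close>

lemma ip_br_v [simp]: "ip (br x y) v = 0"
  by (subst decomposition[of x], subst decomposition[of y]) simp

lemma ip_conn_v [simp]: "ip (g.conn x y) v = 0"
  by (simp add: g.conn)

text \<open>Skewness of \<open>conn x\<close> turns \<open>ip_conn_v\<close> into the first claim;
  as \<open>v\<close> is central, \<open>torsion_free\<close> gives the second.\<close>

lemma conn_v [simp]: "g.conn x v = 0" "g.conn v x = 0"
proof -
  show "g.conn x v = 0" for x
    by (rule g.nondegenerate) (simp add: g.conn_skew[of x v] g.sym[of v])
  then show "g.conn v x = 0"
    by (simp add: g.torsion_free[of v x])
qed

text \<open>The traces of \<open>ad (\<iota> e)\<close> and of \<open>ad v = 0\<close> show that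
  \<open>H\<close> differs from the image of its counterpart in \<open>'b\<close> by a multiple of
  the central vector \<open>v\<close>.\<close>

lemma br_H: "br g.H x = br (\<iota> g0.H) x"
proof -
  have "\<pi> g.H = g0.H"
  proof (rule g0.ip_eqI)
    fix e
    show "ip0 (\<pi> g.H) e = ip0 g0.H e"
      using endo_trace_decomposition[OF g.linear_br(1)[of "\<iota> e"]]
      by (simp add: g.mean_curvature g0.mean_curvature linear_add[OF linear_\<pi>] linear_cmul[OF linear_\<pi>])
  qed
  moreover have "ip g.H v = 0"
    \<comment> \<open>The instance with scalar 0 says that the zero map has trace 0.\<close>
    using endo_trace_decomposition[OF g.linear_br(1)[of v]] endo_trace_scale[OF g0.fd, of 0]
    by (simp add: g.mean_curvature linear_0[OF linear_\<pi>])
  ultimately show ?thesis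
    by (subst decomposition[of g.H]) simp
qed

text \<open>The compression of \<open>\<rho>\<^sub>x\<close> to \<open>\<gg>\<^sub>0\<close>.\<close>

definition \<tau> :: "'a \<Rightarrow> 'b \<Rightarrow> 'b" where "\<tau> x e = \<pi> (g.conn (\<iota> e) x)"

lemma ricci_reduced:
  "ricci br ip x y =
    - (ip (br (\<iota> g0.H) x) y + ip x (br (\<iota> g0.H) y)) / 2 - endo_trace (\<lambda>e. \<tau> x (\<tau> y e))"
proof -
  \<comment> \<open>The inner derivative has no \<open>u\<close>-component by
    \<open>ip_conn_v\<close>, and its \<open>v\<close>-component contributes nothing by
    \<open>conn_v\<close>.\<close>
  have "g.conn (g.conn (\<iota> e) y) x = g.conn (\<iota> (\<tau> y e)) x" for e
    by (subst decomposition[of "g.conn (\<iota> e) y"]) (simp add: \<tau>_def)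
  moreover have "linear (\<lambda>z. g.conn (g.conn z y) x)"
    by (rule linearI) simp_all
  ultimately have "endo_trace (\<lambda>z. g.conn (g.conn z y) x) = endo_trace (\<lambda>e. \<tau> x (\<tau> y e))"
    by (simp add: endo_trace_decomposition \<tau>_def)
  then show ?thesis by (simp add: g.ricci_formula br_H)
qed

text \<open>The \<open>v\<close>-terms of the brackets are orthogonal to the image of
  \<open>\<iota>\<close>, which leaves Koszul's formula of \<open>'b\<close>.\<close>

lemma \<tau>_\<iota> [simp]: "\<tau> (\<iota> f) e = g0.conn e f"
  by (rule g0.ip_eqI) (simp add: \<tau>_def g.conn g0.conn)

lemma \<tau>_v [simp]: "\<tau> v e = 0"
  by (simp add: \<tau>_def linear_0[OF linear_\<pi>])

text \<open>Twice the self-adjoint part of \<open>D\<close>.\<close>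

abbreviation "T \<equiv> (\<lambda>e. D e + adj ip0 D e)"

lemma linear_T: "linear T"
  by (intro linear_compose_add D g0.linear_adj)

lemma T_selfadjoint: "ip0 (T e) f = ip0 e (T f)"
  using g0.sym[of e "adj ip0 D f"] g0.sym[of f "D e"] by (simp add: g0.ip_adj[OF D])

lemma K_skew': "ip0 (K e) f = - ip0 e (K f)"
  using K_skew[of e f] g0.sym[of e] by simp

text \<open>In Koszul's formula the two brackets with \<open>u\<close> contribute \<open>D\<close>
  and its adjoint, and the bracket inside the image of \<open>\<iota>\<close>, paired with
  \<open>u\<close>, contributes \<open>K\<close>.\<close>

lemma \<tau>_u: "\<tau> u e = - (1/2) *\<^sub>R (T e + K e)"
proof (rule g0.ip_eqI)
  fix f
  show "ip0 (\<tau> u e) f = ip0 (- (1/2) *\<^sub>R (T e + K e)) f"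
    using K_skew[of f e] by (simp add: \<tau>_def g.conn g0.ip_adj[OF D] field_simps)
qed

section \<open>Entries of the Ricci tensor\<close>

lemma ricci_\<iota>_\<iota>: "ricci br ip (\<iota> e) (\<iota> f) = ricci br0 ip0 e f"
  by (simp add: ricci_reduced g0.ricci_formula)

lemma ricci_v: "ricci br ip x v = 0"
  using endo_trace_scale[OF g0.fd, of 0]
  by (simp add: ricci_reduced) (simp add: \<tau>_def linear_0[OF linear_\<pi>])

text \<open>The square of \<open>\<tau> u\<close> is a quarter of the square of
  \<open>T + K\<close>, whose mixed terms are traceless; the term with \<open>L\<close> comes from
  the \<open>v\<close>-component of \<open>br (\<iota> g0.H) u\<close>.\<close>

lemma ricci_u_u: "ricci br ip u u = dext_Gamma br0 ip0 D K L"
proof -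
  have TK: "endo_trace (\<lambda>e. T (K e)) = 0"
    by (rule g0.endo_trace_selfadjoint_skew[OF linear_T K T_selfadjoint K_skew'])
  have KT: "endo_trace (\<lambda>e. K (T e)) = 0"
    using TK endo_trace_commute[OF g0.fd g0.fd linear_T K] by simp
  have "endo_trace (\<lambda>e. adj ip0 D (adj ip0 D e)) = endo_trace (\<lambda>e. D (D e))"
    by (rule g0.endo_trace_adjoint[OF linear_compose[OF g0.linear_adj[OF D] g0.linear_adj[OF D], unfolded comp_def]
          linear_compose[OF D D, unfolded comp_def]]) (simp only: g0.ip_adj[OF D])
  moreover have "endo_trace (\<lambda>e. D (adj ip0 D e)) = endo_trace (\<lambda>e. adj ip0 D (D e))"
    by (rule endo_trace_commute[OF g0.fd g0.fd D g0.linear_adj[OF D]])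
  ultimately have TT: "endo_trace (\<lambda>e. T (T e)) =
      2 * endo_trace (\<lambda>e. D (D e)) + 2 * endo_trace (\<lambda>e. adj ip0 D (D e))"
    by (simp add: linear_add[OF D] linear_add[OF g0.linear_adj[OF D]] endo_trace_add[OF g0.fd])
  have "\<tau> u (\<tau> u e) = (1/4) *\<^sub>R (T (T e) + T (K e) + (K (T e) + K (K e)))" for e
    unfolding \<tau>_u linear_cmul[OF linear_T] linear_cmul[OF K] linear_add[OF linear_T] linear_add[OF K]
    by (simp add: algebra_simps)
  then have "endo_trace (\<lambda>e. \<tau> u (\<tau> u e)) = (1/4) * endo_trace (\<lambda>e. T (T e) + T (K e) + (K (T e) + K (K e)))"
    by (simp only: endo_trace_scale[OF g0.fd])
  \<comment> \<open>Additivity is instantiated explicitly because \<open>T\<close> is itself a sum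
    and must stay whole.\<close>
  also have "endo_trace (\<lambda>e. T (T e) + T (K e) + (K (T e) + K (K e))) =
      endo_trace (\<lambda>e. T (T e)) + endo_trace (\<lambda>e. K (K e))"
    unfolding endo_trace_add[OF g0.fd, of "\<lambda>e. T (T e) + T (K e)" "\<lambda>e. K (T e) + K (K e)"]
      endo_trace_add[OF g0.fd, of "\<lambda>e. T (T e)" "\<lambda>e. T (K e)"]
      endo_trace_add[OF g0.fd, of "\<lambda>e. K (T e)" "\<lambda>e. K (K e)"]
    by (simp add: TK KT)
  finally have "endo_trace (\<lambda>e. \<tau> u (\<tau> u e)) = (1/2) * endo_trace (\<lambda>e. D (D e))
      + (1/2) * endo_trace (\<lambda>e. adj ip0 D (D e)) + (1/4) * endo_trace (\<lambda>e. K (K e))"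
    by (simp add: TT)
  then show ?thesis
    by (simp add: ricci_reduced dext_Gamma_def comp_def g.sym[of u])
qed

text \<open>The right side is the functional that defines \<open>dext_Delta\<close>. It arises by
  splitting both factors of the trace into self-adjoint and skew parts, so that only
  \<open>T\<close> against \<open>A + A'\<close> and \<open>K\<close> against \<open>S\<close>
  survive.\<close>

lemma ricci_u_\<iota>:
  "ricci br ip u (\<iota> e) =
     - (1/2) * endo_trace (T \<circ> br0 e) + (1/2) * ip0 (D g0.H - K g0.H) e
     - (1/4) * endo_trace (K \<circ> S_map br0 ip0 e)"
proof -
  define S where "S = S_map br0 ip0 e"
  define A where "A = br0 e"
  define A' where "A' = adj ip0 A"
  have A: "linear A" "linear A'"
    unfolding A'_def A_def by (intro g0.linear_adj g0.linear_br(1))+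
  have adj: "ip0 (A' x) y = ip0 x (A y)" "ip0 (A x) y = ip0 x (A' y)" for x y
    using g0.ip_adj[OF A(1), of x y] g0.ip_adj[OF A(1), of y x] g0.sym[of y] g0.sym[of x]
    by (simp_all add: A'_def)
  have ip_S: "ip0 (S x) y = ip0 e (br0 x y)" for x y
    by (simp add: S_def S_map_def g0.ip_adj[OF g0.linear_br(1)])
  have S: "linear S"
    by (intro linearI g0.ip_eqI) (simp_all add: ip_S)
  have S_skew: "ip0 (S x) y = - ip0 x (S y)" for x y
    using g0.br_anti[of x y] g0.sym[of x "S y"] by (simp add: ip_S)
  \<comment> \<open>The adjoint of \<open>T \<circ> A'\<close> is \<open>A \<circ> T\<close>, which
    has the trace of \<open>T \<circ> A\<close>.\<close>
  have TA': "endo_trace (\<lambda>f. T (A' f)) = endo_trace (\<lambda>f. T (A f))"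
  proof -
    have "endo_trace (\<lambda>f. T (A' f)) = endo_trace (\<lambda>f. A (T f))"
      by (rule g0.endo_trace_adjoint[OF linear_compose[OF A(2) linear_T, unfolded comp_def]
            linear_compose[OF linear_T A(1), unfolded comp_def]]) (simp only: T_selfadjoint adj)
    then show ?thesis
      using endo_trace_commute[OF g0.fd g0.fd linear_T A(1)] by simp
  qed
  have TS: "endo_trace (\<lambda>f. T (S f)) = 0"
    by (rule g0.endo_trace_selfadjoint_skew[OF linear_T S T_selfadjoint S_skew])
  have KA: "endo_trace (\<lambda>f. K (A f + A' f)) = 0"
  proof -
    have lin: "linear (\<lambda>f. A f + A' f)" by (intro linear_compose_add A)
    have "endo_trace (\<lambda>f. A (K f) + A' (K f)) = 0"
      by (rule g0.endo_trace_selfadjoint_skew[OF lin K _ K_skew']) (simp add: adj)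
    then show ?thesis
      using endo_trace_commute[OF g0.fd g0.fd lin K] by simp
  qed
  \<comment> \<open>These are the three Koszul terms: \<open>A + A'\<close> is self-adjoint and
    \<open>S\<close> is skew.\<close>
  have conn: "g0.conn f e = - (1/2) *\<^sub>R (A f + A' f + S f)" for f
  proof (rule g0.ip_eqI)
    fix h
    show "ip0 (g0.conn f e) h = ip0 (- (1/2) *\<^sub>R (A f + A' f + S f)) h"
      using g0.br_anti[of f e] g0.br_anti[of h f] g0.br_anti[of h e] g0.sym[of e "br0 f h"]
      by (simp add: g0.conn adj(1) ip_S) (simp add: A_def field_simps)
  qed
  have "\<tau> u (\<tau> (\<iota> e) f) = (1/4) *\<^sub>R (T (A f) + T (A' f) + T (S f) + K (A f + A' f) + K (S f))" for f
    unfolding \<tau>_u \<tau>_\<iota> conn linear_cmul[OF linear_T] linear_cmul[OF K] linear_add[OF linear_T] linear_add[OF K]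
    by (simp add: algebra_simps)
  then have "endo_trace (\<lambda>f. \<tau> u (\<tau> (\<iota> e) f)) = (1/4) *
      endo_trace (\<lambda>f. T (A f) + T (A' f) + T (S f) + K (A f + A' f) + K (S f))"
    by (simp only: endo_trace_scale[OF g0.fd])
  also have "endo_trace (\<lambda>f. T (A f) + T (A' f) + T (S f) + K (A f + A' f) + K (S f)) =
      endo_trace (\<lambda>f. T (A f)) + endo_trace (\<lambda>f. T (A' f)) + endo_trace (\<lambda>f. T (S f))
      + endo_trace (\<lambda>f. K (A f + A' f)) + endo_trace (\<lambda>f. K (S f))"
    unfolding endo_trace_add[OF g0.fd, of _ "\<lambda>f. K (S f)"]
      endo_trace_add[OF g0.fd, of _ "\<lambda>f. K (A f + A' f)"]
      endo_trace_add[OF g0.fd, of _ "\<lambda>f. T (S f)"]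
      endo_trace_add[OF g0.fd, of _ "\<lambda>f. T (A' f)"] ..
  also have "\<dots> = 2 * endo_trace (\<lambda>f. T (A f)) + endo_trace (\<lambda>f. K (S f))"
    unfolding TA' TS KA by simp
  finally have "endo_trace (\<lambda>f. \<tau> u (\<tau> (\<iota> e) f)) =
      (1/2) * endo_trace (T \<circ> A) + (1/4) * endo_trace (K \<circ> S)"
    by (simp only: comp_def) (simp add: field_simps)
  then show ?thesis
    unfolding ricci_reduced[of u] A_def[symmetric] S_def[symmetric] by (simp add: field_simps)
qed

text \<open>A vanishing \<open>dual_vec\<close> says something about its functional once that is
  known to be linear; linearity is inherited from the Ricci tensor.\<close>

lemma ricci_u_\<iota>_zero:
  assumes "dext_Delta br0 ip0 D K = 0"
  shows "ricci br ip u (\<iota> e) = 0"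
proof -
  have "linear (\<lambda>e. ricci br ip u (\<iota> e))"
    using linear_compose[OF \<iota> g.linear_ricci] by (simp add: comp_def)
  then have "ip0 (dual_vec ip0 (\<lambda>e. ricci br ip u (\<iota> e))) e = ricci br ip u (\<iota> e)"
    by (rule g0.ip_dual_vec)
  then show ?thesis
    using assms by (simp only: ricci_u_\<iota> dext_Delta_def g0.ip_simps)
qed

lemma ricci_eq:
  assumes flat: "ricci_flat br0 ip0" and "dext_Delta br0 ip0 D K = 0"
  shows "ricci br ip x y = dext_Gamma br0 ip0 D K L * ip x v * ip y v"
proof -
  note bil = g.ricci_bil
  have "ricci br ip v y = 0" for y using ricci_v g.ricci_sym by metis
  moreover have "ricci br ip (\<iota> e) u = 0" for e
    using ricci_u_\<iota>_zero[OF assms(2)] g.ricci_sym by metis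
  ultimately show ?thesis
    using flat ricci_u_\<iota>_zero[OF assms(2)]
    by (subst decomposition[of x], subst decomposition[of y])
      (simp add: bilinear_ladd[OF bil] bilinear_radd[OF bil] bilinear_lmul[OF bil] bilinear_rmul[OF bil]
        ricci_u_u ricci_v ricci_\<iota>_\<iota> ricci_flat_def)
qed

end

theorem theorem1p2:
  fixes br :: "'a::real_vector \<Rightarrow> 'a \<Rightarrow> 'a" and ip :: "'a \<Rightarrow> 'a \<Rightarrow> real"
    and br0 :: "'b::real_vector \<Rightarrow> 'b \<Rightarrow> 'b" and ip0 :: "'b \<Rightarrow> 'b \<Rightarrow> real"
    and D K :: "'b \<Rightarrow> 'b" and L :: 'b
  assumes "double_extension br ip br0 ip0 D K L"
    and "ricci_flat br0 ip0"
    and "dext_Delta br0 ip0 D K = 0"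
  shows "ricci_parallel br ip \<and>
    (dext_Gamma br0 ip0 D K L \<noteq> 0 \<longrightarrow>
       ricci_parallel br ip \<and> ricci_op br ip \<noteq> (\<lambda>x. 0) \<and>
       ricci_op br ip \<circ> ricci_op br ip = (\<lambda>x. 0))"
proof -
  obtain u v \<iota> where "dext br ip br0 ip0 D K L u v \<iota>"
    using assms(1) unfolding double_extension_def dext_def metric_lie_def dext_axioms_def by blast
  then interpret dext br ip br0 ip0 D K L u v \<iota> .
  let ?\<Gamma> = "dext_Gamma br0 ip0 D K L"
  note ric = ricci_eq[OF assms(2,3)]
  \<comment> \<open>Covariant derivatives are orthogonal to \<open>v\<close> by
    \<open>ip_conn_v\<close>, so both terms vanish.\<close>
  have parallel: "ricci_parallel br ip"
    by (simp add: ricci_parallel_def ric)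
  have op: "ricci_op br ip x = (?\<Gamma> * ip x v) *\<^sub>R v" for x
    unfolding ricci_op_def by (rule g.dual_vec_eqI) (simp add: ric g.sym[of v])
  \<comment> \<open>\<open>u\<close> serves as witness for a nonzero Ricci operator: its image is
    \<open>?\<Gamma>\<close> times \<open>v\<close>.\<close>
  have "v \<noteq> 0" using ip_uv(1) by (auto simp del: ip_uv)
  then have "ricci_op br ip u \<noteq> 0" if "?\<Gamma> \<noteq> 0"
    using that by (simp add: op)
  \<comment> \<open>The operator has its image in the line of \<open>v\<close> and kills
    \<open>v\<close>, because \<open>v\<close> is null.\<close>
  moreover have "ricci_op br ip \<circ> ricci_op br ip = (\<lambda>x. 0)"
    by (auto simp: op)
  ultimately show ?thesis using parallel by metis
qed

end
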